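(* Let $S_2$ be a primitive non-powerful signed digraph of order $n$ whose underlying digraph is $D_2$, and let $1\le k\le n$. (1) If the two cycles of length $n-1$ of $S_2$ have different signs, then $L(S_2,k) \le (n-k+1)(n-1)+2$. (2) If the two cycles of length $n-1$ of $S_2$ have the same sign, then $L(S_2,k) = (2n-k)(n-1)$.
   Context: A signed digraph $S$ is a digraph (loops allowed, no multiple arcs) on a finite vertex set in which each arc is assigned a sign $1$ or $-1$; its underlying digraph is obtained by forgetting the signs, and its order is its number of vertices. A walk of length $m$ is a sequence of arcs $e_1,\dots,e_m$ such that the terminal vertex of $e_i$ is the initial vertex of $e_{i+1}$; for each vertex $u$ there is also the trivial walk of length $0$ from $u$ to $u$. The sign of a walk (or cycle) is the product of the signs of its arcs (the trivial walk has sign $1$). Two walks form a pair of SSSD walks if they have the same initial vertex, the same terminal vertex, the same length, but different signs. A digraph $D$ is primitive if there is a positive integer $m$ such that for every ordered pair $(u,v)$ of vertices there is a walk of length $m$ from $u$ to $v$; a signed digraph is primitive if its underlying digraph is. A signed digraph is non-powerful if it contains a pair of SSSD walks. For a primitive non-powerful signed digraph $S$ and $X \subseteq V(S)$, $l_S(X)$ is the least integer $p\ge 0$ such that for every vertex $v$ of $S$ there exist $x\in X$ and a pair of SSSD walks of length $p$ from $x$ to $v$; the $k$th upper base is $L(S,k)=\max\{l_S(X) : X\subseteq V(S),\ |X|=k\}$. $D_2$ is the digraph with vertex set $\{1,\dots,n\}$ and arcs $(i,i+1)$ for $1\le i\le n-1$, $(n,1)$, $(n-1,1)$ and $(n,2)$.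 Its only cycles of length $n-1$ are $1\to2\to\cdots\to n-1\to1$ and $2\to3\to\cdots\to n\to2$. *)

theory Defs
  imports "Graph_Theory.Graph_Theory"
begin

text \<open>
  Arcs of a \<^typ>\<open>'a pair_pre_digraph\<close> are pairs of vertices, so there are no multiple arcs,
  while loops are allowed.  Walks are the arc walks of the library, which include
  the trivial walk of length 0 at each vertex.
\<close>

record 'a signed_digraph =
  underlying :: "'a pair_pre_digraph"
  arc_sign :: "'a \<times> 'a \<Rightarrow> int"

abbreviation vertices :: "'a signed_digraph \<Rightarrow> 'a set" where
  "vertices S \<equiv> pverts (underlying S)"

abbreviation is_walk :: "'a pair_pre_digraph \<Rightarrow> 'a \<Rightarrow> ('a \<times> 'a) list \<Rightarrow> 'a \<Rightarrow> bool" where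
  "is_walk D \<equiv> pre_digraph.awalk (with_proj D)"

text \<open>The values of \<^const>\<open>arc_sign\<close> outside the arc set are irrelevant.\<close>

definition is_signed_digraph :: "'a signed_digraph \<Rightarrow> bool" where
  "is_signed_digraph S \<longleftrightarrow>
     pair_fin_digraph (underlying S) \<and>
     (\<forall>e \<in> parcs (underlying S). arc_sign S e = 1 \<or> arc_sign S e = -1)"

definition walk_sign :: "'a signed_digraph \<Rightarrow> ('a \<times> 'a) list \<Rightarrow> int" where
  "walk_sign S w = prod_list (map (arc_sign S) w)"

definition SSSD_pair ::
    "'a signed_digraph \<Rightarrow> 'a \<Rightarrow> 'a \<Rightarrow> nat \<Rightarrow> ('a \<times> 'a) list \<Rightarrow> ('a \<times> 'a) list \<Rightarrow> bool" where
  "SSSD_pair S u v m w w' \<longleftrightarrow>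
     is_walk (underlying S) u w v \<and> is_walk (underlying S) u w' v \<and>
     length w = m \<and> length w' = m \<and> walk_sign S w \<noteq> walk_sign S w'"

definition primitive_digraph :: "'a pair_pre_digraph \<Rightarrow> bool" where
  "primitive_digraph D \<longleftrightarrow>
     (\<exists>m>0. \<forall>u \<in> pverts D. \<forall>v \<in> pverts D. \<exists>w. is_walk D u w v \<and> length w = m)"

definition primitive_signed :: "'a signed_digraph \<Rightarrow> bool" where
  "primitive_signed S \<longleftrightarrow> primitive_digraph (underlying S)"

definition non_powerful :: "'a signed_digraph \<Rightarrow> bool" where
  "non_powerful S \<longleftrightarrow> (\<exists>u v m w w'. SSSD_pair S u v m w w')"

text \<open>
  For a primitive non-powerful signed digraph and a non-empty vertex set \<open>X\<close> a length as below
  exists; only then is the value of \<open>LEAST\<close> meaningful.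
\<close>

definition l_exp :: "'a signed_digraph \<Rightarrow> 'a set \<Rightarrow> nat" where
  "l_exp S X =
     (LEAST p. \<forall>v \<in> vertices S. \<exists>x \<in> X. \<exists>w w'. SSSD_pair S x v p w w')"

definition upper_base :: "'a signed_digraph \<Rightarrow> nat \<Rightarrow> nat" where
  "upper_base S k = Max {l_exp S X | X. X \<subseteq> vertices S \<and> card X = k}"

definition D2 :: "nat \<Rightarrow> nat pair_pre_digraph" where
  "D2 n = \<lparr> pverts = {1..n},
            parcs = {(i, i + 1) | i. 1 \<le> i \<and> i \<le> n - 1} \<union> {(n, 1), (n - 1, 1), (n, 2)} \<rparr>"

definition cycle1 :: "nat \<Rightarrow> (nat \<times> nat) list" where
  "cycle1 n = map (\<lambda>i. (i, i + 1)) [1..<n - 1] @ [(n - 1, 1)]"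

definition cycle2 :: "nat \<Rightarrow> (nat \<times> nat) list" where
  "cycle2 n = map (\<lambda>i. (i, i + 1)) [2..<n] @ [(n, 2)]"

text \<open>
  For \<open>n < 2\<close> the arcs of \<^term>\<open>D2 n\<close> leave the vertex set, so being a signed digraph over
  \<^term>\<open>D2 n\<close> already forces \<open>n \<ge> 2\<close>.
\<close>

lemma pair_fin_digraph_D2_iff: "pair_fin_digraph (D2 n) \<longleftrightarrow> 2 \<le> n"
proof
  assume "pair_fin_digraph (D2 n)"
  then interpret pair_fin_digraph "D2 n" .
  show "2 \<le> n"
    using in_arcsD1[of "n - 1" 1] by (auto simp: D2_def)
next
  assume n: "2 \<le> n"
  have "finite {(i, i + 1) | i. 1 \<le> i \<and> i \<le> n - 1}"
    by (rule finite_subset[of _ "{..n} \<times> {..n}"]) (use n in auto)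
  then show "pair_fin_digraph (D2 n)"
    using n by unfold_locales (auto simp: D2_def)
qed

lemma pcas_ascending:
  "a \<le> b \<Longrightarrow> pcas a (map (\<lambda>i. (i, i + 1)) [a..<b] @ w) v \<longleftrightarrow> pcas b w v"
proof (induction b arbitrary: w)
  case (Suc b)
  then show ?case by (cases "a = Suc b") auto
qed simp

lemma pawalk_verts_ascending:
  "a \<le> b \<Longrightarrow> pawalk_verts a (map (\<lambda>i. (i, i + 1)) [a..<b] @ [(b, c)]) = [a..<Suc b] @ [c]"
proof (induction "b - a" arbitrary: a)
  case (Suc d)
  then have "[a..<b] = a # [Suc a..<b]" by (simp add: upt_conv_Cons)
  with Suc show ?case by (simp add: upt_conv_Cons)
qed simp

lemma cycle1_cycle:
  assumes "2 \<le> n"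
  shows "pre_digraph.cycle (with_proj (D2 n)) (cycle1 n)" and "length (cycle1 n) = n - 1"
proof -
  show "pre_digraph.cycle (with_proj (D2 n)) (cycle1 n)"
    unfolding pre_digraph.cycle_def pre_digraph.awalk_def
  proof (intro exI[of _ 1] conjI)
    show "distinct (tl (pre_digraph.awalk_verts (with_proj (D2 n)) 1 (cycle1 n)))"
      using assms pawalk_verts_ascending[of 1 "n - 1" 1]
      by (auto simp: cycle1_def awalk_verts_with_proj_eq upt_conv_Cons)
    show "pre_digraph.cas (with_proj (D2 n)) 1 (cycle1 n) 1"
      using assms pcas_ascending[of 1 "n - 1" "[(n - 1, 1)]" 1]
      by (simp add: cycle1_def cas_with_proj_eq)
  qed (use assms in \<open>auto simp: D2_def cycle1_def\<close>)
  show "length (cycle1 n) = n - 1"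
    using assms by (simp add: cycle1_def)
qed

lemma cycle2_cycle:
  assumes "2 \<le> n"
  shows "pre_digraph.cycle (with_proj (D2 n)) (cycle2 n)" and "length (cycle2 n) = n - 1"
proof -
  show "pre_digraph.cycle (with_proj (D2 n)) (cycle2 n)"
    unfolding pre_digraph.cycle_def pre_digraph.awalk_def
  proof (intro exI[of _ 2] conjI)
    show "distinct (tl (pre_digraph.awalk_verts (with_proj (D2 n)) 2 (cycle2 n)))"
      using assms pawalk_verts_ascending[of 2 n 2] upt_conv_Cons[of 2 "Suc n"]
      by (simp add: cycle2_def awalk_verts_with_proj_eq del: upt_Suc)
    show "pre_digraph.cas (with_proj (D2 n)) 2 (cycle2 n) 2"
      using assms pcas_ascending[of 2 n "[(n, 2)]" 2]
      by (simp add: cycle2_def cas_with_proj_eq)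
  qed (use assms in \<open>auto simp: D2_def cycle2_def\<close>)
  show "length (cycle2 n) = n - 1"
    using assms by (simp add: cycle2_def)
qed

end

theory Submission
  imports Defs
begin

text \<open>
  A walk from \<open>u\<close> to \<open>v\<close> that uses the arc \<open>(n, 1)\<close> \<open>p\<close> times and the arcs \<open>(n - 1, 1)\<close>
  and \<open>(n, 2)\<close> \<open>s\<close> times in total has length \<open>v - u + n p + (n - 1) s\<close>, and its sign is,
  up to a factor depending only on \<open>u\<close> and \<open>v\<close>, the product of the signs of the cycles it winds
  around.  Almost all pairs \<open>(p, s)\<close> occur.  If the short cycles have different signs, a walk
  with \<open>s \<ge> 1\<close> therefore has a partner of the opposite sign.  If they have equal signs, a pair
  must trade \<open>n - 1\<close> long turns for \<open>n\<close> short ones, so it needs the extra length \<open>n (n - 1)\<close>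
  and otherwise exists iff the rest of the length lies in the semigroup generated by \<open>n - 1\<close>
  and \<open>n\<close>.  At the claimed length a suitable pair ending in \<open>v\<close> exists whenever \<open>x - v\<close>
  (shifted by 2 for different signs) has residue at most \<open>n - k\<close> modulo \<open>n\<close>; since only
  \<open>k - 1\<close> residues are excluded, one of \<open>k\<close> initial vertices \<open>x\<close> works.  For equal signs the
  set \<open>{1} \<union> {n - k + 2..n}\<close> and the terminal vertex \<open>n\<close> show that the length is optimal.
\<close>

section \<open>Walks in \<open>D2 n\<close>\<close>

lemma is_walk_append:
  assumes "2 \<le> n" "is_walk (D2 n) u w v" "is_walk (D2 n) v w' x"
  shows "is_walk (D2 n) u (w @ w') x"
proof -
  interpret pair_fin_digraph "D2 n"
    using assms(1) by (simp add: pair_fin_digraph_D2_iff)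
  show ?thesis
    using assms(2,3) by (rule awalk_appendI)
qed

lemma is_walk_Cons_iff:
  assumes "2 \<le> n"
  shows "is_walk (D2 n) u (e # w) v \<longleftrightarrow> e \<in> parcs (D2 n) \<and> u = fst e \<and> is_walk (D2 n) (snd e) w v"
proof -
  interpret pair_fin_digraph "D2 n"
    using assms(1) by (simp add: pair_fin_digraph_D2_iff)
  show ?thesis
    by (simp add: awalk_Cons_iff)
qed

lemma is_walk_Nil_iff: "is_walk (D2 n) u [] v \<longleftrightarrow> u = v \<and> 1 \<le> u \<and> u \<le> n"
  by (auto simp: pre_digraph.awalk_def pre_digraph.cas.simps D2_def)

lemma arc_D2_cases:
  assumes "(u, v) \<in> parcs (D2 n)"
  obtains (up) "v = u + 1" "1 \<le> u" "u < n" | (long) "u = n" "v = 1"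
    | (short1) "u = n - 1" "v = 1" | (short2) "u = n" "v = 2"
  using assms by (auto simp: D2_def)

text \<open>A common last arc multiplies both signs by the same nonzero factor.\<close>

lemma SSSD_pair_extend:
  assumes "2 \<le> n" "underlying S = D2 n" "SSSD_pair S u v m w w'"
    and "(v, x) \<in> parcs (D2 n)" "arc_sign S (v, x) \<noteq> 0"
  shows "SSSD_pair S u x (Suc m) (w @ [(v, x)]) (w' @ [(v, x)])"
proof -
  have "1 \<le> x \<and> x \<le> n"
    using assms(1,4) by (auto simp: D2_def)
  then have "is_walk (D2 n) v [(v, x)] x"
    using assms by (simp add: is_walk_Cons_iff is_walk_Nil_iff)
  then show ?thesis
    using assms by (auto simp: SSSD_pair_def walk_sign_def intro: is_walk_append)
qed

section \<open>Residues and two coprime generators\<close>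

text \<open>The shifted elements of \<open>X\<close> have distinct residues modulo \<open>n\<close>,
  and only \<open>k - 1\<close> residues exceed \<open>n - k\<close>.\<close>

lemma pigeonhole_residue:
  fixes n k :: nat and c :: int
  assumes "X \<subseteq> {1..n}" "card X = k" "1 \<le> k" "k \<le> n"
  shows "\<exists>x \<in> X. (int x + c) mod int n \<le> int n - int k"
proof (rule ccontr)
  assume no: "\<not> ?thesis"
  then have bad: "(int x + c) mod int n > int n - int k" if "x \<in> X" for x
    using no that not_le by blast
  have inj: "inj_on (\<lambda>x. (int x + c) mod int n) X"
  proof (rule inj_onI)
    fix x y assume xy: "x \<in> X" "y \<in> X" "(int x + c) mod int n = (int y + c) mod int n"
    then have "int n dvd int x - int y"
      by (metis add_diff_cancel_right mod_eq_dvd_iff)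
    moreover have "\<bar>int x - int y\<bar> < int n"
      using subsetD[OF assms(1) xy(1)] subsetD[OF assms(1) xy(2)] by (simp add: abs_less_iff)
    ultimately show "x = y"
      using dvd_imp_le_int[of "int x - int y" "int n"] by auto
  qed
  have "(\<lambda>x. (int x + c) mod int n) ` X \<subseteq> {int n - int k + 1..<int n}"
    using bad assms by force
  then have "card X \<le> card {int n - int k + 1..<int n}"
    using card_inj_on_le[OF inj] by blast
  then show False
    using assms by simp
qed

text \<open>Since \<open>n - 1\<close> and \<open>n\<close> are coprime, \<open>n - 1\<close>
  divides \<open>p - p'\<close>.\<close>

lemma two_generators_collision:
  fixes n p s p' s' :: nat
  assumes "2 \<le> n" "n * p + (n - 1) * s = n * p' + (n - 1) * s'" "p' \<le> p"
  obtains c where "p = p' + (n - 1) * c" "s' = s + n * c"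
proof -
  obtain a where a: "n = Suc a" "0 < a"
    using assms(1) by (cases n) auto
  obtain e where e: "p = p' + e"
    using assms(3) by (metis le_iff_add)
  have eq: "Suc a * e + a * s = a * s'"
    using assms(2) by (simp add: a e algebra_simps)
  then have "a dvd Suc a * e"
    by (metis dvd_add_left_iff dvd_triv_left)
  then have "a dvd e"
    by (metis coprime_Suc_right_nat coprime_dvd_mult_right_iff)
  then obtain c where c: "e = a * c" ..
  have "a * s' = a * (s + n * c)"
    using eq by (simp add: a c algebra_simps)
  then have "s' = s + n * c"
    using a by (metis mult_cancel_left neq0_conv)
  then show thesis
    using that e c a by simp
qed

lemma sign_sq: "(x::int) = 1 \<or> x = -1 \<Longrightarrow> x * x = 1"
  by auto

section \<open>Gauged signs in a signed \<open>D2 n\<close>\<close>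

locale signed_D2 =
  fixes S :: "nat signed_digraph" and n :: nat
  assumes signed: "is_signed_digraph S" and underlying: "underlying S = D2 n"
begin

lemma n_ge_2: "2 \<le> n"
  using signed by (simp add: is_signed_digraph_def underlying pair_fin_digraph_D2_iff)

lemma arc_sign_cases: "e \<in> parcs (D2 n) \<Longrightarrow> arc_sign S e = 1 \<or> arc_sign S e = -1"
  using signed by (simp add: is_signed_digraph_def underlying)

text \<open>
  Multiplying the sign of a walk by the gauges of its two ends makes every arc
  \<open>(i, i + 1)\<close> positive and does not change the sign of a closed walk.
\<close>

definition gauge :: "nat \<Rightarrow> int" where
  "gauge i = prod_list (map (\<lambda>j. arc_sign S (j, j + 1)) [1..<i])"

text \<open>The sign of the Hamiltonian cycle through \<open>1, 2, ..., n\<close>.\<close>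

definition long_sign :: int where
  "long_sign = gauge n * arc_sign S (n, 1)"

text \<open>Recording the gauged sign makes concatenation multiplicative and gives ascending paths
  the sign 1.\<close>

definition connected_by :: "nat \<Rightarrow> nat \<Rightarrow> nat \<Rightarrow> int \<Rightarrow> bool" where
  "connected_by u v m \<sigma> \<longleftrightarrow>
     (\<exists>w. is_walk (D2 n) u w v \<and> length w = m \<and> gauge u * gauge v * walk_sign S w = \<sigma>)"

abbreviation sign1 :: int where "sign1 \<equiv> walk_sign S (cycle1 n)"
abbreviation sign2 :: int where "sign2 \<equiv> walk_sign S (cycle2 n)"

lemma gauge_1 [simp]: "gauge 1 = 1" "gauge (Suc 0) = 1"
  by (simp_all add: gauge_def)

lemma gauge_Suc: "1 \<le> i \<Longrightarrow> gauge (Suc i) = gauge i * arc_sign S (i, Suc i)"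
  by (simp add: gauge_def)

lemma gauge_cases: "1 \<le> i \<Longrightarrow> i \<le> n \<Longrightarrow> gauge i = 1 \<or> gauge i = -1"
proof (induction i rule: dec_induct)
  case (step i)
  then have "arc_sign S (i, Suc i) = 1 \<or> arc_sign S (i, Suc i) = -1"
    by (intro arc_sign_cases) (auto simp: D2_def)
  with step show ?case by (auto simp: gauge_Suc)
qed simp

lemma gauge_sq [simp]: "1 \<le> i \<Longrightarrow> i \<le> n \<Longrightarrow> gauge i * gauge i = 1"
  using gauge_cases sign_sq by blast

lemma gauge_sq_left [simp]: "1 \<le> i \<Longrightarrow> i \<le> n \<Longrightarrow> gauge i * (gauge i * x) = x"
  by (metis gauge_sq mult.assoc mult_1)

lemma sign1_eq: "sign1 = gauge (n - 1) * arc_sign S (n - 1, 1)"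
  by (simp add: cycle1_def walk_sign_def gauge_def o_def)

text \<open>\<open>gauge n\<close> contains the arc \<open>(1, 2)\<close>, which
  \<open>cycle2\<close> avoids; the factor \<open>gauge 2\<close> cancels it.\<close>

lemma sign2_eq: "sign2 = gauge 2 * gauge n * arc_sign S (n, 2)"
proof -
  have "[1..<n] = 1 # [2..<n]"
    using n_ge_2 by (simp add: upt_conv_Cons numeral_2_eq_2)
  then have "gauge n = gauge 2 * prod_list (map (\<lambda>j. arc_sign S (j, j + 1)) [2..<n])"
    by (simp add: gauge_def numeral_2_eq_2)
  then show ?thesis
    using n_ge_2 by (simp add: cycle2_def walk_sign_def o_def mult.assoc)
qed

lemma cycle_sign_cases:
  "sign1 = 1 \<or> sign1 = -1" "sign2 = 1 \<or> sign2 = -1" "long_sign = 1 \<or> long_sign = -1"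
proof -
  have "1 \<le> n - 1" "1 \<le> n" "n - 1 \<le> n" "1 \<le> (2::nat)" "2 \<le> n"
    using n_ge_2 by auto
  note g = gauge_cases[OF this(1,3)] gauge_cases[OF this(2) order_refl] gauge_cases[OF this(4,5)]
  have a: "arc_sign S (n, 1) = 1 \<or> arc_sign S (n, 1) = -1"
    "arc_sign S (n - 1, 1) = 1 \<or> arc_sign S (n - 1, 1) = -1"
    "arc_sign S (n, 2) = 1 \<or> arc_sign S (n, 2) = -1"
    by (intro arc_sign_cases; simp add: D2_def)+
  show "sign1 = 1 \<or> sign1 = -1" "sign2 = 1 \<or> sign2 = -1" "long_sign = 1 \<or> long_sign = -1"
    unfolding sign1_eq sign2_eq long_sign_def using g a by auto
qed

section \<open>Length and gauged sign of an arbitrary walk\<close>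

lemma arc_verts: "(u, v) \<in> parcs (D2 n) \<Longrightarrow> 1 \<le> u \<and> u \<le> n \<and> 1 \<le> v \<and> v \<le> n"
  using n_ge_2 by (auto simp: D2_def)

lemma walk_verts:
  assumes "is_walk (D2 n) u w v"
  shows "1 \<le> u" "u \<le> n" "1 \<le> v" "v \<le> n"
proof -
  interpret pair_fin_digraph "D2 n"
    using n_ge_2 by (simp add: pair_fin_digraph_D2_iff)
  show "1 \<le> u" "u \<le> n" "1 \<le> v" "v \<le> n"
    using awalk_hd_in_verts[OF assms] awalk_last_in_verts[OF assms]
    by (auto simp: D2_def)
qed

text \<open>An arc either climbs by one or closes a cycle. A closing arc descends by one less than
  the length of its cycle, and its gauged sign is the sign of that cycle.\<close>

lemma arc_invariant:
  assumes "(u, v) \<in> parcs (D2 n)"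
  obtains p q r where "1 + u = v + n * p + (n - 1) * (q + r)"
    "gauge u * gauge v * arc_sign S (u, v) = long_sign ^ p * sign1 ^ q * sign2 ^ r"
  using assms
proof (cases rule: arc_D2_cases)
  case up
  then show ?thesis
    using that[of 0 0 0] arc_sign_cases[OF assms] sign_sq[of "arc_sign S (u, v)"]
    by (simp add: gauge_Suc mult.assoc)
next
  case long
  then show ?thesis
    using that[of 1 0 0] by (simp add: long_sign_def)
next
  case short1
  then show ?thesis
    using that[of 0 1 0] n_ge_2 by (simp add: sign1_eq)
next
  case short2
  then show ?thesis
    using that[of 0 0 1] n_ge_2 by (simp add: sign2_eq mult_ac)
qed

text \<open>The arc invariants accumulate along the walk: \<open>p\<close>, \<open>q\<close> and
  \<open>r\<close> count its uses of \<open>(n, 1)\<close>, \<open>(n - 1, 1)\<close> and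
  \<open>(n, 2)\<close>.\<close>

lemma walk_invariant:
  assumes "is_walk (D2 n) u w v"
  shows "\<exists>p q r. length w + u = v + n * p + (n - 1) * (q + r) \<and>
    gauge u * gauge v * walk_sign S w = long_sign ^ p * sign1 ^ q * sign2 ^ r"
  using assms
proof (induction w arbitrary: u)
  case Nil
  then have "u = v" "1 \<le> u" "u \<le> n"
    by (auto simp: is_walk_Nil_iff)
  then show ?case
    by (intro exI[of _ 0]) (simp add: walk_sign_def)
next
  case (Cons e w)
  obtain x where e: "e = (u, x)" "(u, x) \<in> parcs (D2 n)" and w: "is_walk (D2 n) x w v"
    using Cons.prems n_ge_2 by (cases e) (auto simp: is_walk_Cons_iff)
  have x: "1 \<le> x" "x \<le> n"
    using e(2) n_ge_2 by (auto simp: D2_def)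
  obtain p q r where 1: "1 + u = x + n * p + (n - 1) * (q + r)"
    "gauge u * gauge x * arc_sign S (u, x) = long_sign ^ p * sign1 ^ q * sign2 ^ r"
    using arc_invariant[OF e(2)] .
  obtain p' q' r' where 2: "length w + x = v + n * p' + (n - 1) * (q' + r')"
    "gauge x * gauge v * walk_sign S w = long_sign ^ p' * sign1 ^ q' * sign2 ^ r'"
    using Cons.IH[OF w] by blast
  \<comment> \<open>Inserting the square of \<open>gauge x\<close>, which is 1, splits the gauged
    sign at the intermediate vertex.\<close>
  have "gauge u * gauge v * walk_sign S (e # w)
      = (gauge x * gauge x) * (gauge u * gauge v * walk_sign S (e # w))"
    using x by simp
  also have "\<dots> = (gauge u * gauge x * arc_sign S (u, x)) * (gauge x * gauge v * walk_sign S w)"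
    by (simp add: walk_sign_def e mult_ac)
  also have "\<dots> = long_sign ^ (p + p') * sign1 ^ (q + q') * sign2 ^ (r + r')"
    unfolding 1 2 by (simp add: power_add mult_ac)
  finally have "gauge u * gauge v * walk_sign S (e # w)
      = long_sign ^ (p + p') * sign1 ^ (q + q') * sign2 ^ (r + r')" .
  moreover have "length (e # w) + u = v + n * (p + p') + (n - 1) * ((q + q') + (r + r'))"
    using 1(1) 2(1) by (simp add: distrib_left)
  ultimately show ?case by blast
qed

section \<open>Building walks of given length and gauged sign\<close>

lemma connected_by_trans:
  assumes "connected_by u v m \<sigma>" "connected_by v x l \<tau>" "1 \<le> v" "v \<le> n"
  shows "connected_by u x (m + l) (\<sigma> * \<tau>)"
proof -
  obtain w w' where w: "is_walk (D2 n) u w v" "length w = m" "gauge u * gauge v * walk_sign S w = \<sigma>"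
    and w': "is_walk (D2 n) v w' x" "length w' = l" "gauge v * gauge x * walk_sign S w' = \<tau>"
    using assms unfolding connected_by_def by blast
  have "\<sigma> * \<tau> = (gauge v * gauge v) * (gauge u * gauge x * (walk_sign S w * walk_sign S w'))"
    unfolding w(3)[symmetric] w'(3)[symmetric] by (simp only: mult_ac)
  also have "\<dots> = gauge u * gauge x * (walk_sign S (w @ w'))"
    using assms by (simp add: walk_sign_def)
  finally show ?thesis
    unfolding connected_by_def using is_walk_append[OF n_ge_2 w(1) w'(1)] w(2) w'(2) by force
qed

lemma connected_by_refl: "1 \<le> u \<Longrightarrow> u \<le> n \<Longrightarrow> connected_by u u 0 1"
  unfolding connected_by_def by (intro exI[of _ "[]"]) (simp add: is_walk_Nil_iff walk_sign_def)

lemma connected_by_arc: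
  "(u, v) \<in> parcs (D2 n) \<Longrightarrow> connected_by u v 1 (gauge u * gauge v * arc_sign S (u, v))"
  unfolding connected_by_def using n_ge_2 arc_verts
  by (intro exI[of _ "[(u, v)]"]) (simp add: is_walk_Cons_iff is_walk_Nil_iff walk_sign_def)

lemma connected_by_up:
  assumes "u \<le> v" "1 \<le> u" "v \<le> n"
  shows "connected_by u v (v - u) 1"
  using assms
proof (induction v rule: dec_induct)
  case base
  then show ?case by (simp add: connected_by_refl)
next
  case (step v)
  have arc: "(v, Suc v) \<in> parcs (D2 n)"
    using step by (auto simp: D2_def)
  have "gauge v * gauge (Suc v) * arc_sign S (v, Suc v) = 1"
    using step arc_sign_cases[OF arc] sign_sq[of "arc_sign S (v, Suc v)"]
    by (simp add: gauge_Suc mult.assoc)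
  then have "connected_by u (Suc v) (v - u + 1) (1 * 1)"
    using step connected_by_trans[of u v _ 1 "Suc v" 1 1] connected_by_arc[OF arc] by simp
  then show ?case
    using step by (simp add: Suc_diff_le)
qed

text \<open>The climbs from \<open>u\<close> to \<open>a\<close> and from \<open>b\<close> to
  \<open>v\<close> have gauged sign 1, so only the arc between them contributes.\<close>

lemma connected_by_jump:
  assumes "1 \<le> u" "u \<le> a" "a \<le> n" "1 \<le> b" "b \<le> v" "v \<le> n" "(a, b) \<in> parcs (D2 n)"
    and "m = (a - u) + 1 + (v - b)"
  shows "connected_by u v m (gauge a * gauge b * arc_sign S (a, b))"
  using connected_by_trans[OF connected_by_trans[OF connected_by_up connected_by_arc] connected_by_up,
    of u a b v] assms by simp

lemma connected_by_long:
  assumes "1 \<le> u" "u \<le> n" "1 \<le> v" "v \<le> n" "m + u = n + v"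
  shows "connected_by u v m long_sign"
proof -
  have "m = (n - u) + 1 + (v - 1)" using assms by linarith
  then show ?thesis
    using connected_by_jump[of u n 1 v m] assms n_ge_2 by (simp add: D2_def long_sign_def)
qed

text \<open>The start must lie at or below \<open>n - 1\<close>, so that the closing arc
  \<open>(n - 1, 1)\<close> is reached by climbing.\<close>

lemma connected_by_short1:
  assumes "1 \<le> u" "u \<le> n - 1" "1 \<le> v" "v \<le> n" "m + u = (n - 1) + v"
  shows "connected_by u v m sign1"
proof -
  have "m = (n - 1 - u) + 1 + (v - 1)" using assms by linarith
  then show ?thesis
    using connected_by_jump[of u "n - 1" 1 v m] assms n_ge_2 by (simp add: D2_def sign1_eq)
qed

text \<open>The end must lie at or above 2, so that it is reached by climbing after the arc
  \<open>(n, 2)\<close>.\<close>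

lemma connected_by_short2:
  assumes "1 \<le> u" "u \<le> n" "2 \<le> v" "v \<le> n" "m + u = (n - 1) + v"
  shows "connected_by u v m sign2"
proof -
  have "m = (n - u) + 1 + (v - 2)" using assms by linarith
  then show ?thesis
    using connected_by_jump[of u n 2 v m] assms n_ge_2 by (simp add: D2_def sign2_eq mult_ac)
qed

lemma connected_by_iterate:
  assumes "connected_by u u l \<tau>" "connected_by u v m \<sigma>" "1 \<le> u" "u \<le> n"
  shows "connected_by u v (l * s + m) (\<tau> ^ s * \<sigma>)"
proof (induction s)
  case (Suc s)
  then show ?case
    using connected_by_trans[OF assms(1) Suc] assms by (simp add: mult_ac add_ac)
qed (use assms in simp)

text \<open>The long cycle passes through every vertex, so its turns can be put in front of any
  walk.\<close>

lemma connected_by_add_long: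
  assumes "connected_by u v m \<sigma>" "1 \<le> u" "u \<le> n"
  shows "connected_by u v (n * p + m) (long_sign ^ p * \<sigma>)"
  using assms by (intro connected_by_iterate connected_by_long) auto

section \<open>From walks to SSSD pairs and bases\<close>

lemma SSSD_pairI:
  assumes "connected_by u v m \<sigma>" "connected_by u v m \<tau>" "\<sigma> \<noteq> \<tau>"
  shows "\<exists>w w'. SSSD_pair S u v m w w'"
  using assms unfolding connected_by_def SSSD_pair_def underlying by metis

text \<open>Every vertex has an in-neighbour, so a pair ending there extends by one arc. Hence the
  lengths that serve all vertices are upward closed.\<close>

lemma SSSD_pair_mono:
  assumes "\<forall>v \<in> {1..n}. \<exists>x \<in> X. \<exists>w w'. SSSD_pair S x v m w w'" "m \<le> m'"
  shows "\<forall>v \<in> {1..n}. \<exists>x \<in> X. \<exists>w w'. SSSD_pair S x v m' w w'"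
  using assms(2,1)
proof (induction m' rule: dec_induct)
  case (step m')
  show ?case
  proof
    fix v assume v: "v \<in> {1..n}"
    obtain y where y: "y \<in> {1..n}" "(y, v) \<in> parcs (D2 n)"
    proof (cases "v = 1")
      case True
      then show ?thesis using that[of n] n_ge_2 by (auto simp: D2_def)
    next
      case False
      then have "1 \<le> v - 1" "v - 1 \<le> n - 1" "v - 1 + 1 = v" using v by auto
      then show ?thesis using that[of "v - 1"] by (force simp: D2_def)
    qed
    then obtain x w w' where "x \<in> X" "SSSD_pair S x y m' w w'"
      using step by blast
    then show "\<exists>x \<in> X. \<exists>w w'. SSSD_pair S x v (Suc m') w w'"
      using SSSD_pair_extend[OF n_ge_2 underlying _ y(2)] arc_sign_cases[OF y(2)]
      by (metis zero_neq_neg_one zero_neq_one)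
  qed
qed

lemma vertices_eq: "vertices S = {1..n}"
  by (simp add: underlying D2_def)

lemma l_exp_le:
  assumes "\<And>v. 1 \<le> v \<Longrightarrow> v \<le> n \<Longrightarrow> \<exists>x \<in> X. \<exists>w w'. SSSD_pair S x v m w w'"
  shows "l_exp S X \<le> m"
  unfolding l_exp_def vertices_eq by (rule Least_le) (use assms in simp)

lemma
  shows upper_base_le:
      "k \<le> n \<Longrightarrow> (\<And>X. X \<subseteq> {1..n} \<Longrightarrow> card X = k \<Longrightarrow> l_exp S X \<le> b) \<Longrightarrow> upper_base S k \<le> b"
    and upper_base_ge: "X \<subseteq> {1..n} \<Longrightarrow> card X = k \<Longrightarrow> l_exp S X \<le> upper_base S k"
proof -
  let ?A = "{l_exp S X | X. X \<subseteq> vertices S \<and> card X = k}"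
  have "?A = l_exp S ` {X. X \<subseteq> vertices S \<and> card X = k}" by auto
  then have fin: "finite ?A" by (simp add: vertices_eq)
  show "upper_base S k \<le> b" if "k \<le> n" "\<And>X. X \<subseteq> {1..n} \<Longrightarrow> card X = k \<Longrightarrow> l_exp S X \<le> b"
  proof -
    \<comment> \<open>The set \<open>{1..k}\<close> shows that the maximum is taken over a non-empty
      set.\<close>
    have "{1..k} \<subseteq> {1..n}" "card {1..k} = k" using that by auto
    then have "?A \<noteq> {}" unfolding vertices_eq by blast
    then show ?thesis
      unfolding upper_base_def using fin that(2) by (auto simp: vertices_eq)
  qed
  show "l_exp S X \<le> upper_base S k" if "X \<subseteq> {1..n}" "card X = k"
    unfolding upper_base_def using that by (intro Max_ge fin) (auto simp: vertices_eq)
qed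

section \<open>Walks with prescribed numbers of turns\<close>

text \<open>If \<open>u < v\<close>, then \<open>cycle1\<close> can be attached at \<open>u\<close>
  and \<open>cycle2\<close> at \<open>v\<close>. Otherwise one long turn leads through
  \<open>n\<close> and then 1, where \<open>cycle2\<close> and \<open>cycle1\<close> can be
  attached.\<close>

lemma connected_by_cycles:
  assumes uv: "1 \<le> u" "u \<le> n" "1 \<le> v" "v \<le> n"
    and len: "m + u = v + n * p + (n - 1) * (q + r)" and p: "1 \<le> p \<or> u < v"
  shows "connected_by u v m (long_sign ^ p * sign1 ^ q * sign2 ^ r)"
proof -
  have n: "1 \<le> n - 1" "1 \<le> n" "n - 1 + 1 = n"
    using n_ge_2 by auto
  show ?thesis
  proof (cases "u < v")
    case True
    have "connected_by v v ((n - 1) * r + 0) (sign2 ^ r * 1)"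
      using uv True n by (intro connected_by_iterate connected_by_short2 connected_by_refl) auto
    moreover have "connected_by u v (v - u) 1"
      using uv True by (intro connected_by_up) auto
    ultimately have "connected_by u v ((v - u) + ((n - 1) * r + 0)) (1 * (sign2 ^ r * 1))"
      using uv by (intro connected_by_trans[of u v _ _ v]) auto
    moreover have "connected_by u u (n - 1) sign1"
      using uv True by (intro connected_by_short1) auto
    ultimately have "connected_by u v ((n - 1) * q + ((v - u) + ((n - 1) * r + 0))) (sign1 ^ q * (1 * (sign2 ^ r * 1)))"
      using uv by (intro connected_by_iterate) auto
    then have "connected_by u v (n * p + ((n - 1) * q + ((v - u) + ((n - 1) * r + 0))))
        (long_sign ^ p * (sign1 ^ q * (1 * (sign2 ^ r * 1))))"
      using uv by (intro connected_by_add_long)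
    moreover have "n * p + ((n - 1) * q + ((v - u) + ((n - 1) * r + 0))) = m"
      using len True by (simp add: distrib_left)
    ultimately show ?thesis by (simp add: mult_ac)
  next
    case False
    \<comment> \<open>The arc \<open>(n, 1)\<close> of the connecting walk uses up one long turn;
      the other \<open>p'\<close> are added at \<open>u\<close>.\<close>
    then obtain p' where p': "p = Suc p'"
      using p by (cases p) auto
    have "connected_by n n ((n - 1) * r + 0) (sign2 ^ r * 1)"
      using uv n by (intro connected_by_iterate connected_by_short2 connected_by_refl n_ge_2) auto
    then have "connected_by u n ((n - u) + ((n - 1) * r + 0)) (1 * (sign2 ^ r * 1))"
      using uv n connected_by_up[of u n] by (intro connected_by_trans[of u n _ _ n]) auto
    moreover have "connected_by n 1 1 long_sign"
      using n by (intro connected_by_long) auto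
    ultimately have "connected_by u 1 ((n - u) + ((n - 1) * r + 0) + 1) (1 * (sign2 ^ r * 1) * long_sign)"
      using n by (intro connected_by_trans[of u n _ _ 1]) auto
    moreover have "connected_by 1 v ((n - 1) * q + (v - 1)) (sign1 ^ q * 1)"
      using uv n by (intro connected_by_iterate connected_by_short1 connected_by_up) auto
    ultimately have "connected_by u v ((n - u) + ((n - 1) * r + 0) + 1 + ((n - 1) * q + (v - 1)))
        (1 * (sign2 ^ r * 1) * long_sign * (sign1 ^ q * 1))"
      using n by (intro connected_by_trans[of u 1 _ _ v]) auto
    then have "connected_by u v (n * p' + ((n - u) + ((n - 1) * r + 0) + 1 + ((n - 1) * q + (v - 1))))
        (long_sign ^ p' * (1 * (sign2 ^ r * 1) * long_sign * (sign1 ^ q * 1)))"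
      using uv by (intro connected_by_add_long)
    moreover have "n * p' + ((n - u) + ((n - 1) * r + 0) + 1 + ((n - 1) * q + (v - 1))) = m"
      using len uv by (simp add: distrib_left p')
    ultimately show ?thesis by (simp add: mult_ac p')
  qed
qed

text \<open>Trading a single turn around one short cycle for a turn around the other flips the sign.\<close>

lemma SSSD_pair_different:
  assumes diff: "sign1 \<noteq> sign2" and uv: "1 \<le> u" "u \<le> n" "1 \<le> v" "v \<le> n"
    and len: "m + u = v + n * p + (n - 1) * s" and s: "1 \<le> s" and p: "1 \<le> p \<or> u < v"
  shows "\<exists>w w'. SSSD_pair S u v m w w'"
proof -
  have "m + u = v + n * p + (n - 1) * (0 + s)" "m + u = v + n * p + (n - 1) * (1 + (s - 1))"
    using len s by simp_all
  from this[THEN connected_by_cycles[OF uv]]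
  have "connected_by u v m (long_sign ^ p * sign1 ^ 0 * sign2 ^ s)"
    "connected_by u v m (long_sign ^ p * sign1 ^ 1 * sign2 ^ (s - 1))"
    using p by blast+
  moreover have "long_sign ^ p * sign1 ^ 0 * sign2 ^ s \<noteq> long_sign ^ p * sign1 ^ 1 * sign2 ^ (s - 1)"
  proof -
    have "sign2 ^ s = sign2 * sign2 ^ (s - 1)"
      using s by (cases s) auto
    moreover have "long_sign ^ p \<noteq> 0" "sign2 ^ (s - 1) \<noteq> 0"
      using cycle_sign_cases by auto
    ultimately show ?thesis
      using diff by simp
  qed
  ultimately show ?thesis
    by (rule SSSD_pairI)
qed

section \<open>Short cycles of different signs: the bound\<close>

lemma upper_base_le_if_different:
  assumes diff: "sign1 \<noteq> sign2" and k: "1 \<le> k" "k \<le> n"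
  shows "upper_base S k \<le> (n - k + 1) * (n - 1) + 2"
proof (intro upper_base_le k(2) l_exp_le)
  fix X v assume X: "X \<subseteq> {1..n}" "card X = k" and v: "1 \<le> v" "v \<le> n"
  \<comment> \<open>The shift by 2 matches the summand 2 of the length. Modulo \<open>n\<close> the
    length equation forces \<open>s\<close> to be congruent to \<open>n - k + 1\<close> minus this
    residue, so a residue of at most \<open>n - k\<close> permits \<open>1 <= s\<close>.\<close>
  obtain x where x: "x \<in> X" "(int x + (2 - int v)) mod int n \<le> int n - int k"
    using pigeonhole_residue[OF X k] by blast
  define i where "i = int x + (2 - int v)"
  define j where "j = nat (i mod int n)"
  define t where "t = n - k"
  have xn: "1 \<le> x" "x \<le> n"
    using x(1) X by auto
  have j: "int j = i mod int n" "j < n" "j \<le> t"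
    using x(2) k n_ge_2 by (auto simp: j_def i_def t_def nat_less_iff nat_le_iff)
  have i: "i = int j + int n * (i div int n)"
    by (simp add: j(1))
  have "i div int n \<le> 1" "- 1 \<le> i div int n"
  proof -
    have "i < int n * 2" "- int n \<le> i"
      using xn v n_ge_2 by (auto simp: i_def)
    then have "int n * (i div int n) < int n * 2" "int n * (-2) < int n * (i div int n)"
      using i j(2) by linarith+
    then have "i div int n < 2" "-2 < i div int n"
      using n_ge_2 by (auto simp only: mult_less_cancel_left)
    then show "i div int n \<le> 1" "- 1 \<le> i div int n"
      by linarith+
  qed
  then consider "i div int n = 0" | "i div int n = 1" | "i div int n = -1"
    by linarith
  \<comment> \<open>In all three cases \<open>p = j + i div n\<close> and
    \<open>s = t - j + 1\<close>. If \<open>p = 0\<close>, then \<open>x < v\<close>.\<close>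
  then obtain p s where "(t + 1) * (n - 1) + 2 + x = v + n * p + (n - 1) * s" "1 \<le> s"
    "1 \<le> p \<or> x < v"
  proof cases
    case 1
    then have eq: "x + 2 = v + j"
      using i by (simp add: i_def)
    obtain e where e: "t = j + e"
      using j(3) by (metis le_iff_add)
    obtain a where a: "n = Suc a" using n_ge_2 by (cases n) auto
    show ?thesis
      using that[of j "e + 1"] eq by (force simp: e a algebra_simps)
  next
    case 2
    then have eq: "x + 2 = v + j + n"
      using i by (simp add: i_def)
    obtain e where e: "t = j + e"
      using j(3) by (metis le_iff_add)
    obtain a where a: "n = Suc a" using n_ge_2 by (cases n) auto
    have "j \<le> 1" using eq xn v by linarith
    show ?thesis
      using that[of "j + 1" "e + 1"] eq by (simp add: e a algebra_simps)
  next
    case 3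
    then have eq: "x + 2 + n = v + j"
      using i by (simp add: i_def)
    obtain e where e: "t = j + e"
      using j(3) by (metis le_iff_add)
    obtain a where a: "n = Suc a" using n_ge_2 by (cases n) auto
    obtain b where b: "j = Suc b" using eq v by (cases j) auto
    show ?thesis
      using that[of b "e + 1"] eq v j(2) by (force simp: e a b algebra_simps)
  qed
  then show "\<exists>x \<in> X. \<exists>w w'. SSSD_pair S x v ((n - k + 1) * (n - 1) + 2) w w'"
    using x(1) SSSD_pair_different[OF diff xn v] unfolding t_def by blast
qed

section \<open>Short cycles of equal signs: existence of pairs\<close>

lemma walk_invariant_equal:
  assumes "sign1 = sign2" "is_walk (D2 n) u w v"
  obtains p s where "length w + u = v + n * p + (n - 1) * s"
    "gauge u * gauge v * walk_sign S w = long_sign ^ p * sign1 ^ s"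
proof -
  obtain p q r where "length w + u = v + n * p + (n - 1) * (q + r)"
    "gauge u * gauge v * walk_sign S w = long_sign ^ p * sign1 ^ q * sign2 ^ r"
    using walk_invariant[OF assms(2)] by blast
  then show thesis
    using that[of p "q + r"] assms(1) by (simp add: power_add mult.assoc)
qed

text \<open>
  The two members of a pair differ by trading \<open>n - 1\<close> turns around the long cycle for
  \<open>n\<close> turns around the short ones, an odd number of times.
\<close>

lemma SSSD_pair_equal:
  assumes eq: "sign1 = sign2" and pair: "SSSD_pair S u v m w w'"
  shows "(long_sign ^ (n - 1) * sign1 ^ n = -1) \<and>
    (\<exists>p s. m + u = v + n * (n - 1) + n * p + (n - 1) * s)"
proof -
  have wlog: "(long_sign ^ (n - 1) * sign1 ^ n = -1) \<and>
      (\<exists>p s. m + u = v + n * (n - 1) + n * p + (n - 1) * s)"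
    if 1: "m + u = v + n * p + (n - 1) * s" and 2: "m + u = v + n * p' + (n - 1) * s'"
      and le: "p' \<le> p" and ne: "long_sign ^ p * sign1 ^ s \<noteq> long_sign ^ p' * sign1 ^ s'"
    for p s p' s'
  proof -
    have "n * p + (n - 1) * s = n * p' + (n - 1) * s'"
      using 1 2 by simp
    then obtain c where c: "p = p' + (n - 1) * c" "s' = s + n * c"
      using two_generators_collision[OF n_ge_2 _ le] by metis
    have "c \<noteq> 0"
      using c ne by (intro notI) simp
    then obtain d where d: "c = Suc d"
      by (cases c) auto
    \<comment> \<open>If the product were 1, trading turns would preserve the sign, contrary to
      \<open>ne\<close>.\<close>
    have "long_sign ^ (n - 1) * sign1 ^ n \<noteq> 1"
    proof
      assume one: "long_sign ^ (n - 1) * sign1 ^ n = 1"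
      have sq: "(sign1 ^ n) * (sign1 ^ n) = 1"
        using cycle_sign_cases(1) by (metis mult_1 power_mult_distrib power_one sign_sq)
      then have "long_sign ^ (n - 1) = sign1 ^ n"
        using one by (metis mult.assoc mult.right_neutral mult_1)
      then have "long_sign ^ ((n - 1) * c) = sign1 ^ (n * c)"
        by (simp add: power_mult)
      then show False
        using ne c by (simp add: power_add mult_ac)
    qed
    moreover have "long_sign ^ (n - 1) * sign1 ^ n = 1 \<or> long_sign ^ (n - 1) * sign1 ^ n = -1"
    proof -
      have "\<bar>long_sign ^ (n - 1) * sign1 ^ n\<bar> = 1"
        using cycle_sign_cases(1,3) by (auto simp: abs_mult power_abs)
      then show ?thesis by linarith
    qed
    \<comment> \<open>One of the \<open>c = d + 1\<close> traded blocks of \<open>n - 1\<close> long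
      turns supplies \<open>n * (n - 1)\<close>; the others stay among the long turns.\<close>
    moreover have "m + u = v + n * (n - 1) + n * (p' + (n - 1) * d) + (n - 1) * s"
      using 1 by (cases n) (simp_all add: c d algebra_simps)
    ultimately show ?thesis by blast
  qed
  have w: "is_walk (D2 n) u w v" "length w = m" and w': "is_walk (D2 n) u w' v" "length w' = m"
    and ne: "walk_sign S w \<noteq> walk_sign S w'"
    using pair by (auto simp: SSSD_pair_def underlying)
  obtain p s where ps: "m + u = v + n * p + (n - 1) * s"
    "gauge u * gauge v * walk_sign S w = long_sign ^ p * sign1 ^ s"
    using walk_invariant_equal[OF eq w(1)] w(2) by metis
  obtain p' s' where ps': "m + u = v + n * p' + (n - 1) * s'"
    "gauge u * gauge v * walk_sign S w' = long_sign ^ p' * sign1 ^ s'"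
    using walk_invariant_equal[OF eq w'(1)] w'(2) by metis
  have bnds: "1 \<le> u" "u \<le> n" "1 \<le> v" "v \<le> n"
    using walk_verts[OF w(1)] by auto
  then have "gauge u * gauge v \<noteq> 0"
    using gauge_cases[of u] gauge_cases[of v] by auto
  then have ne: "long_sign ^ p * sign1 ^ s \<noteq> long_sign ^ p' * sign1 ^ s'"
    using ne ps(2) ps'(2) by (metis mult_cancel_left)
  show ?thesis
    using wlog[OF ps(1) ps'(1) _ ne] wlog[OF ps'(1) ps(1) _ ne[symmetric]] by (meson nat_le_linear)
qed

text \<open>With equal signs either short cycle may serve: \<open>cycle1\<close> for starts below
  \<open>n\<close>, \<open>cycle2\<close> for the start \<open>n\<close>. The pair
  \<open>(n, 1)\<close> needs a long turn here, because a single short turn would leave length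
  0.\<close>

lemma connected_by_equal:
  assumes eq: "sign1 = sign2" and uv: "1 \<le> u" "u \<le> n" "1 \<le> v" "v \<le> n"
    and len: "m + u = v + n * p + (n - 1) * s" and ps: "1 \<le> p \<or> 1 \<le> s \<and> (u, v) \<noteq> (n, 1)"
  shows "connected_by u v m (long_sign ^ p * sign1 ^ s)"
proof (cases "1 \<le> p \<or> u < v")
  case True
  then show ?thesis
    using connected_by_cycles[OF uv, of m p s 0] len by simp
next
  case False
  then obtain s' where s': "p = 0" "s = Suc s'"
    using ps by (cases s) auto
  have loop: "connected_by u u (n - 1) sign1"
    using uv eq connected_by_short1[of u u] connected_by_short2[of u u] n_ge_2
    by (cases "u = n") auto
  have "connected_by u v (n - 1 + v - u) sign1"
    using uv eq ps s' connected_by_short1[of u v] connected_by_short2[of u v] n_ge_2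
    by (cases "u = n") auto
  from connected_by_iterate[OF loop this uv(1,2), of s']
  have "connected_by u v ((n - 1) * s' + (n - 1 + v - u)) (sign1 ^ s' * sign1)" .
  moreover have "(n - 1) * s' + (n - 1 + v - u) = m"
    using len uv n_ge_2 by (simp add: s')
  ultimately show ?thesis
    by (simp add: s' mult_ac)
qed

text \<open>One walk spends the length \<open>n * (n - 1)\<close> on \<open>n - 1\<close> long
  turns, the other on \<open>n\<close> short ones, and \<open>odd\<close> makes their signs differ.
  The last condition is for the second walk, which makes only \<open>p\<close> long turns.\<close>

lemma SSSD_pair_equal_exists:
  assumes eq: "sign1 = sign2" and odd: "long_sign ^ (n - 1) * sign1 ^ n = -1"
    and uv: "1 \<le> u" "u \<le> n" "1 \<le> v" "v \<le> n"
    and len: "m + u = v + n * (n - 1) + n * p + (n - 1) * s" and p: "1 \<le> p \<or> (u, v) \<noteq> (n, 1)"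
  shows "\<exists>w w'. SSSD_pair S u v m w w'"
proof -
  have "connected_by u v m (long_sign ^ (p + (n - 1)) * sign1 ^ s)"
  proof (rule connected_by_equal[OF eq uv])
    show "m + u = v + n * (p + (n - 1)) + (n - 1) * s"
      using len by (simp add: distrib_left del: One_nat_def)
  qed (use n_ge_2 in auto)
  moreover have "connected_by u v m (long_sign ^ p * sign1 ^ (s + n))"
    using n_ge_2 len p by (intro connected_by_equal[OF eq uv]) (auto simp: distrib_left distrib_right mult.commute)
  moreover have "long_sign ^ (p + (n - 1)) * sign1 ^ s \<noteq> long_sign ^ p * sign1 ^ (s + n)"
  proof
    assume "long_sign ^ (p + (n - 1)) * sign1 ^ s = long_sign ^ p * sign1 ^ (s + n)"
    then have "long_sign ^ (n - 1) = sign1 ^ n"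
      using cycle_sign_cases(1,3) by (auto simp: power_add)
    \<comment> \<open>Equal factors make the product a square.\<close>
    then have "0 \<le> long_sign ^ (n - 1) * sign1 ^ n"
      by simp
    then show False using odd by simp
  qed
  ultimately show ?thesis by (rule SSSD_pairI)
qed

lemma SSSD_pair_equal_all:
  assumes eq: "sign1 = sign2" and odd: "long_sign ^ (n - 1) * sign1 ^ n = -1"
    and k: "1 \<le> k" "k \<le> n" and X: "X \<subseteq> {1..n}" "card X = k" and v: "1 \<le> v" "v \<le> n"
  shows "\<exists>x \<in> X. \<exists>w w'. SSSD_pair S x v ((2 * n - k) * (n - 1)) w w'"
proof -
  obtain x where x: "x \<in> X" "(int x + (- int v)) mod int n \<le> int n - int k"
    using pigeonhole_residue[OF X k] by blast
  define i where "i = int x - int v"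
  define j where "j = nat (i mod int n)"
  define t where "t = n - k"
  have xn: "1 \<le> x" "x \<le> n"
    using x(1) X by auto
  have j: "int j = i mod int n" "j < n" "j \<le> t"
    using x(2) k n_ge_2 by (auto simp: j_def i_def t_def nat_less_iff nat_le_iff)
  obtain e where e: "t = j + e"
    using j(3) by (metis le_iff_add)
  obtain a where a: "n = Suc a" "1 \<le> a"
    using n_ge_2 by (cases n) auto
  have m: "(2 * n - k) * (n - 1) = (n + t) * (n - 1)"
    using k by (simp add: t_def mult_2)
  \<comment> \<open>Beyond \<open>n * (n - 1)\<close> the length \<open>t * (n - 1)\<close> remains.
    The witnesses are \<open>s = t - j\<close> and \<open>p = j\<close>, with \<open>p\<close>
    lowered by one if \<open>x < v\<close>. For \<open>(n, 1)\<close> the residue \<open>j\<close>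
    is \<open>n - 1\<close>, so \<open>p\<close> is positive.\<close>
  obtain p s where "(n + t) * (n - 1) + x = v + n * (n - 1) + n * p + (n - 1) * s"
    "1 \<le> p \<or> (x, v) \<noteq> (n, 1)"
  proof (cases "v \<le> x")
    case True
    then have "i mod int n = i"
      using xn v by (intro mod_pos_pos_trivial) (auto simp: i_def)
    then have "x = v + j"
      using j(1) by (simp add: i_def)
    then show ?thesis
      using that[of j e] a by (force simp: e algebra_simps)
  next
    case False
    then have "(i + int n) mod int n = i + int n"
      using xn v by (intro mod_pos_pos_trivial) (auto simp: i_def)
    then have xj: "x + n = v + j"
      using j(1) by (simp add: i_def)
    then obtain b where b: "j = Suc b"
      using xn v by (cases j) auto
    show ?thesis
      using that[of b e] a False xj xn by (force simp: e b algebra_simps)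
  qed
  then show ?thesis
    using x(1) SSSD_pair_equal_exists[OF eq odd xn v] unfolding m by blast
qed

section \<open>Short cycles of equal signs: the exact value\<close>

lemma no_pair_equal:
  assumes eq: "sign1 = sign2" and k: "1 \<le> k" "k \<le> n" and x: "x = 1 \<or> n - k + 2 \<le> x \<and> x \<le> n"
  shows "\<not> SSSD_pair S x n ((2 * n - k) * (n - 1) - 1) w w'"
proof
  assume "SSSD_pair S x n ((2 * n - k) * (n - 1) - 1) w w'"
  then obtain p s where ps: "(2 * n - k) * (n - 1) - 1 + x = n + n * (n - 1) + n * p + (n - 1) * s"
    using SSSD_pair_equal[OF eq] by blast
  obtain a where a: "n = Suc a" "1 \<le> a"
    using n_ge_2 by (cases n) auto
  define t where "t = n - k"
  have m: "(2 * n - k) * (n - 1) = (n + t) * (n - 1)"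
    using k by (simp add: t_def mult_2)
  have x1: "1 \<le> x" using x by auto
  \<comment> \<open>The climb from \<open>x\<close> to \<open>n\<close>, plus the 1 missing from the
    length.\<close>
  define y where "y = n + 1 - x"
  have xn: "x \<le> n" using x k by auto
  have y: "1 \<le> y" "y + t \<le> a \<or> y = Suc a \<and> t \<le> a"
    using x xn k a by (auto simp: y_def t_def)
  have "int a * int t = int a * (int p + int s) + int p + int y"
  proof -
    have "1 \<le> (n + t) * (n - 1)" using a by simp
    then have "int ((2 * n - k) * (n - 1) - 1 + x) = (int n + int t) * int a - 1 + int x"
      unfolding m by (simp add: a algebra_simps)
    then show ?thesis
      unfolding ps y_def using xn by (simp add: a algebra_simps)
  qed
  then have main: "int p + int y = int a * (int t - int p - int s)"
    by (simp add: algebra_simps)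
  define e where "e = int t - int p - int s"
  have main: "int p + int y = int a * e"
    using main by (simp add: e_def)
  have "0 < int a * e"
    using main y by linarith
  then have e: "1 \<le> e"
    using a by (simp add: zero_less_mult_iff)
  have p: "int p \<le> int t - e"
    by (simp add: e_def)
  from y(2) show False
  proof
    assume "y + t \<le> a"
    then have "int a * e < int a * 1"
      using main p e by linarith
    then show False
      using e a by (simp add: mult_less_cancel_left)
  next
    assume y: "y = Suc a \<and> t \<le> a"
    then have "int a * 1 < int a * e"
      using main by linarith
    then have "2 \<le> e"
      using a by (simp add: mult_less_cancel_left)
    \<comment> \<open>For \<open>x = 1\<close> the bound \<open>e >= 2\<close> limits
      \<open>p\<close> to \<open>t - 2\<close>, just enough for a strict inequality.\<close>
    then have "int a * e < int a * 2"
      using main p y by linarith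
    then show False
      using \<open>2 \<le> e\<close> a by (simp add: mult_less_cancel_left)
  qed
qed

lemma upper_base_if_equal:
  assumes eq: "sign1 = sign2" and np: "non_powerful S" and k: "1 \<le> k" "k \<le> n"
  shows "upper_base S k = (2 * n - k) * (n - 1)"
proof (rule antisym)
  \<comment> \<open>Non-powerfulness supplies one pair, and any pair forces this sign.\<close>
  have odd: "long_sign ^ (n - 1) * sign1 ^ n = -1"
    using np SSSD_pair_equal[OF eq] unfolding non_powerful_def by blast
  show "upper_base S k \<le> (2 * n - k) * (n - 1)"
    by (intro upper_base_le k(2) l_exp_le SSSD_pair_equal_all[OF eq odd k])
  \<comment> \<open>Vertex 1 and the last \<open>k - 1\<close> vertices: none of them starts a pair
    to \<open>n\<close> of length one below the claimed value.\<close>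
  define X where "X = insert 1 {n - k + 2..n}"
  have X: "X \<subseteq> {1..n}" "card X = k"
    using k by (auto simp: X_def)
  let ?m = "(2 * n - k) * (n - 1)"
  have "?m \<le> l_exp S X"
    unfolding l_exp_def vertices_eq
  proof (rule LeastI2)
    show "\<forall>v \<in> {1..n}. \<exists>x \<in> X. \<exists>w w'. SSSD_pair S x v ?m w w'"
      using SSSD_pair_equal_all[OF eq odd k X] by simp
    fix m assume m: "\<forall>v \<in> {1..n}. \<exists>x \<in> X. \<exists>w w'. SSSD_pair S x v m w w'"
    show "?m \<le> m"
    proof (rule ccontr)
      assume "\<not> ?m \<le> m"
      \<comment> \<open>By monotonicity it suffices to refute the single length
        \<open>?m - 1\<close>.\<close>
      then have "\<forall>v \<in> {1..n}. \<exists>x \<in> X. \<exists>w w'. SSSD_pair S x v (?m - 1) w w'"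
        by (intro SSSD_pair_mono[OF m]) simp
      then obtain x w w' where "x \<in> X" "SSSD_pair S x n (?m - 1) w w'"
        using n_ge_2 by force
      then show False
        using no_pair_equal[OF eq k] by (auto simp: X_def)
    qed
  qed
  then show "?m \<le> upper_base S k"
    using upper_base_ge[OF X] by simp
qed

end

theorem theorem3p5:
  fixes S\<^sub>2 :: "nat signed_digraph" and n k :: nat
  assumes "is_signed_digraph S\<^sub>2"
    and "underlying S\<^sub>2 = D2 n"
    and "primitive_signed S\<^sub>2"
    and "non_powerful S\<^sub>2"
    and "1 \<le> k" and "k \<le> n"
  shows "(walk_sign S\<^sub>2 (cycle1 n) \<noteq> walk_sign S\<^sub>2 (cycle2 n) \<longrightarrow>
            upper_base S\<^sub>2 k \<le> (n - k + 1) * (n - 1) + 2) \<and>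
         (walk_sign S\<^sub>2 (cycle1 n) = walk_sign S\<^sub>2 (cycle2 n) \<longrightarrow>
            upper_base S\<^sub>2 k = (2 * n - k) * (n - 1))"
proof -
  interpret signed_D2 S\<^sub>2 n
    using assms by unfold_locales
  show ?thesis
    using upper_base_le_if_different upper_base_if_equal assms by blast
qed

end
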